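(* Let $F$ be the free monoid on $\pi_1,\pi_2$, let $T$ be the monoid of $F$-colored binary trees, and let $U=T/\!\sim_{cp}$. Let $B\in U$ be represented by $\tilde B\in T$. Then $B$ has a left inverse in $U$ (there is $A\in U$ with $AB=1$) if and only if the family of colors of the leaves of $\tilde B$ is left cofinite.
   Context: A CQP monoid $(M,\Sigma,\pi_1,\pi_2)$ is a monoid $M$ with elements $\pi_1,\pi_2\in M$ and a function $\Sigma:M^2\to M$ such that $\pi_1\Sigma(a,b)=a$, $\pi_2\Sigma(a,b)=b$, and $\Sigma(ac,bc)=\Sigma(a,b)c$ for all $a,b,c\in M$. A congruence on it is an equivalence relation $\sim$ such that $a\sim b$ and $c\sim d$ imply $ac\sim bd$ and $\Sigma(a,c)\sim\Sigma(b,d)$. The CQP monoid $T$: $T$ is the set of finite nonempty ordered binary trees (each non-leaf vertex has exactly one left child and one right child) whose leaves are colored by elements of $F$; equivalently, the free magma with basis $F$. $\Sigma(A,B)$ is the tree whose root has left subtree $A$ and right subtree $B$. Elements of $F$ are identified with the one-vertex trees, and each $A\in T$ is either in $F$ or uniquely $A=\Sigma(A_1,A_2)$. $F$ acts on $T$ from the left: $\pi_i$ sends $w\in F$ to the word $\pi_iw$, and sends $\Sigma(A_1,A_2)$ to $A_i$; a word acts by applying its symbols one at a time from right to left. The product $AB$ is the tree obtained from $A$ by replacing each leaf of color $w\in F$ by $wB$. With this product, identity $1\in F$, $\Sigma$, and $\pi_1,\pi_2\in F$, $T$ is a CQP monoid. $\sim_{cp}$ is the smallest congruence on $T$ such that $\Sigma(\pi_1,\pi_2)\sim_{cp}1$,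 and $U=T/\!\sim_{cp}$ with the induced monoid structure. A family $w_1,\dots,w_n$ of elements of a free monoid $G$ is left cofinite if all but finitely many $y\in G$ can be written $y=xw_i$ for some $x\in G$ and some $i$. The family of colors of the leaves of a tree is indexed by its leaves. *)

theory Defs
  imports Main
begin

class cqp_monoid = monoid_mult +
  fixes Sg :: "'a \<Rightarrow> 'a \<Rightarrow> 'a"
    and pi1 :: 'a
    and pi2 :: 'a
  assumes pi1_Sg: "pi1 * Sg a b = a"
    and pi2_Sg: "pi2 * Sg a b = b"
    and Sg_mult: "Sg (a * c) (b * c) = Sg a b * c"

definition cqp_congruence :: "('a::cqp_monoid \<Rightarrow> 'a \<Rightarrow> bool) \<Rightarrow> bool" where
  "cqp_congruence R \<longleftrightarrow> equivp R \<and>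
     (\<forall>a b c d. R a b \<longrightarrow> R c d \<longrightarrow> R (a * c) (b * d) \<and> R (Sg a c) (Sg b d))"

datatype generator = P1 | P2

text \<open>The free monoid \<open>F\<close>: the list \<open>[x\<^sub>1, \<dots>, x\<^sub>n]\<close> is the word \<open>x\<^sub>1 \<cdots> x\<^sub>n\<close>,
  so \<open>[]\<close> is the identity and \<open>@\<close> is the product.\<close>

type_synonym word = "generator list"

datatype tree = Leaf word | Fork tree tree

fun gen_act :: "generator \<Rightarrow> tree \<Rightarrow> tree" where
  "gen_act g (Leaf w) = Leaf (g # w)"
| "gen_act P1 (Fork A B) = A"
| "gen_act P2 (Fork A B) = B"

text \<open>\<open>foldr\<close> applies the last symbol of the word first.\<close>

definition act :: "word \<Rightarrow> tree \<Rightarrow> tree" where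
  "act w A = foldr gen_act w A"

fun tree_mult :: "tree \<Rightarrow> tree \<Rightarrow> tree" where
  "tree_mult (Leaf w) B = act w B"
| "tree_mult (Fork A1 A2) B = Fork (tree_mult A1 B) (tree_mult A2 B)"

lemma act_Nil [simp]: "act [] A = A"
  by (simp add: act_def)

lemma act_Cons [simp]: "act (g # w) A = gen_act g (act w A)"
  by (simp add: act_def)

lemma tree_mult_gen_act: "tree_mult (gen_act g A) B = gen_act g (tree_mult A B)"
  by (cases g; cases A) auto

lemma tree_mult_act: "tree_mult (act w A) B = act w (tree_mult A B)"
  by (induction w) (simp_all add: tree_mult_gen_act)

lemma tree_mult_assoc: "tree_mult (tree_mult A B) C = tree_mult A (tree_mult B C)"
  by (induction A) (simp_all add: tree_mult_act)

lemma act_Leaf_Nil: "act w (Leaf []) = Leaf w"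
  by (induction w) auto

lemma tree_mult_Leaf_Nil: "tree_mult A (Leaf []) = A"
  by (induction A) (simp_all add: act_Leaf_Nil)

instantiation tree :: cqp_monoid
begin

definition one_tree :: tree where "1 = Leaf []"
definition times_tree :: "tree \<Rightarrow> tree \<Rightarrow> tree" where "A * B = tree_mult A B"
definition Sg_tree :: "tree \<Rightarrow> tree \<Rightarrow> tree" where "Sg A B = Fork A B"
definition pi1_tree :: tree where "pi1 = Leaf [P1]"
definition pi2_tree :: tree where "pi2 = Leaf [P2]"

instance
  by standard
    (simp_all add: one_tree_def times_tree_def Sg_tree_def pi1_tree_def pi2_tree_def
      tree_mult_assoc tree_mult_Leaf_Nil)

end

definition cp :: "tree \<Rightarrow> tree \<Rightarrow> bool" where
  "cp A B \<longleftrightarrow> (\<forall>R. cqp_congruence R \<longrightarrow> R (Sg pi1 pi2) 1 \<longrightarrow> R A B)"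

lemma cp_pi: "cp (Sg pi1 pi2) 1"
  by (simp add: cp_def)

lemma cp_congruence: "cqp_congruence cp"
  unfolding cqp_congruence_def
proof (intro conjI allI impI)
  show "equivp cp"
  proof (rule equivpI)
    show "reflp cp"
      unfolding reflp_def cp_def cqp_congruence_def by (blast intro: equivp_reflp)
    show "symp cp"
      unfolding symp_def cp_def cqp_congruence_def by (blast intro: equivp_symp)
    show "transp cp"
      unfolding transp_def cp_def cqp_congruence_def by (blast intro: equivp_transp)
  qed
next
  fix a b c d assume "cp a b" "cp c d"
  then show "cp (a * c) (b * d)" "cp (Sg a c) (Sg b d)"
    unfolding cp_def cqp_congruence_def by blast+
qed

lemma cp_equivp: "equivp cp"
  using cp_congruence by (simp add: cqp_congruence_def)

quotient_type U = tree / cp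
  morphisms rep_U class_of
  by (rule cp_equivp)

instantiation U :: cqp_monoid
begin

lift_definition one_U :: U is "1 :: tree" .

lift_definition times_U :: "U \<Rightarrow> U \<Rightarrow> U" is "(*) :: tree \<Rightarrow> tree \<Rightarrow> tree"
  using cp_congruence by (simp add: cqp_congruence_def)

lift_definition Sg_U :: "U \<Rightarrow> U \<Rightarrow> U" is "Sg :: tree \<Rightarrow> tree \<Rightarrow> tree"
  using cp_congruence by (simp add: cqp_congruence_def)

lift_definition pi1_U :: U is "pi1 :: tree" .

lift_definition pi2_U :: U is "pi2 :: tree" .

instance
proof
  fix a b c :: U
  show "a * b * c = a * (b * c)"
    by transfer (simp add: mult.assoc equivp_reflp[OF cp_equivp])
  show "1 * a = a"
    by transfer (simp add: equivp_reflp[OF cp_equivp])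
  show "a * 1 = a"
    by transfer (simp add: equivp_reflp[OF cp_equivp])
  show "pi1 * Sg a b = a"
    by transfer (simp add: pi1_Sg equivp_reflp[OF cp_equivp])
  show "pi2 * Sg a b = b"
    by transfer (simp add: pi2_Sg equivp_reflp[OF cp_equivp])
  show "Sg (a * c) (b * c) = Sg a b * c"
    by transfer (simp add: Sg_mult equivp_reflp[OF cp_equivp])
qed

end

definition left_cofinite :: "'a list list \<Rightarrow> bool" where
  "left_cofinite ws \<longleftrightarrow> finite {y. \<not> (\<exists>x. \<exists>i<length ws. y = x @ ws ! i)}"

text \<open>The family of leaf colors, in left-to-right order and with repetitions.\<close>

fun leaf_colors :: "tree \<Rightarrow> word list" where
  "leaf_colors (Leaf w) = [w]"
| "leaf_colors (Fork A B) = leaf_colors A @ leaf_colors B"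

end

theory Submission
  imports Defs
begin

text \<open>
  A word acting on a tree walks down from the root, its last symbol first, and whatever is left of
  the word after reaching a leaf is put in front of the color of that leaf.  A long word therefore
  always turns a tree into a single leaf, and the equivalence \<open>cp\<close> respects this behaviour:
  equivalent trees are acted on in the same way by all sufficiently long words
  (\<open>cp_imp_eventually_same_act\<close>), because eventual agreement is itself a congruence identifying
  \<open>Sg pi1 pi2\<close> with \<open>1\<close>.

  If \<open>A * B = 1\<close> in \<open>U\<close>, then a long word \<open>y\<close> satisfies \<open>(y A) B = y\<close> with \<open>y A\<close> a single word \<open>u\<close>,
  so \<open>y\<close> arises by letting \<open>u\<close> act on \<open>B\<close>.  Every color so obtained ends in a color of a leaf of
  \<open>B\<close> (\<open>leaf_colors_act\<close>); hence the only exceptions to left cofiniteness are short words.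

  Conversely, if \<open>y = x c\<close> with \<open>c\<close> the color of a leaf of \<open>B\<close>, then \<open>y = (x p) B\<close>, where \<open>p\<close> is the
  path to that leaf.  Left cofiniteness thus makes every word of some fixed length \<open>n\<close> a left
  multiple of \<open>B\<close> in \<open>T\<close>.  Modulo \<open>cp\<close> a word \<open>w\<close> is the fork of \<open>P1 # w\<close> and \<open>P2 # w\<close>, and left
  multiples of \<open>B\<close> are closed under forks, so being a left multiple descends from words of length
  \<open>n\<close> to the empty word, which is \<open>1\<close>.
\<close>

section \<open>The action of long words\<close>

lemma act_append: "act (v @ w) A = act v (act w A)"
  by (simp add: act_def)

lemma act_Leaf: "act w (Leaf c) = Leaf (w @ c)"
  by (induction w) auto

text \<open>Walking down to a leaf uses up at most as many symbols as the tree is high, so the height can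
  serve as \<open>d\<close>.  The lower bound on the length of the resulting color keeps it long
  enough to act on a second tree.\<close>

lemma long_word_act_Leaf:
  "\<exists>d. \<forall>w. d \<le> length w \<longrightarrow> (\<exists>u. act w A = Leaf u \<and> length w \<le> length u + d)"
proof (induction A)
  case (Leaf c)
  show ?case by (rule exI[of _ 0]) (auto simp: act_Leaf)
next
  case (Fork A1 A2)
  obtain d1 where d1:
    "\<And>w. d1 \<le> length w \<Longrightarrow> \<exists>u. act w A1 = Leaf u \<and> length w \<le> length u + d1"
    using Fork.IH(1) by blast
  obtain d2 where d2:
    "\<And>w. d2 \<le> length w \<Longrightarrow> \<exists>u. act w A2 = Leaf u \<and> length w \<le> length u + d2"
    using Fork.IH(2) by blast
  have "\<exists>u. act w (Fork A1 A2) = Leaf u \<and> length w \<le> length u + Suc (max d1 d2)"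
    if long: "Suc (max d1 d2) \<le> length w" for w
  proof (cases w rule: rev_cases)
    case Nil
    then show ?thesis using long by simp
  next
    case (snoc v g)
    show ?thesis
    proof (cases g)
      case P1
      then show ?thesis using d1[of v] long snoc by (fastforce simp: act_append)
    next
      case P2
      then show ?thesis using d2[of v] long snoc by (fastforce simp: act_append)
    qed
  qed
  then show ?case by blast
qed

section \<open>An invariant of the congruence\<close>

definition eventually_same_act :: "tree \<Rightarrow> tree \<Rightarrow> bool" where
  "eventually_same_act A B \<longleftrightarrow> (\<exists>n. \<forall>w. n \<le> length w \<longrightarrow> act w A = act w B)"

lemma eventually_same_act_trans:
  assumes "eventually_same_act A B" and "eventually_same_act B C"
  shows "eventually_same_act A C"
proof -
  obtain m n where "\<forall>w. m \<le> length w \<longrightarrow> act w A = act w B"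
    and "\<forall>w. n \<le> length w \<longrightarrow> act w B = act w C"
    using assms unfolding eventually_same_act_def by blast
  then show ?thesis
    unfolding eventually_same_act_def by (intro exI[of _ "max m n"]) simp
qed

lemma equivp_eventually_same_act: "equivp eventually_same_act"
proof (rule equivpI)
  show "reflp eventually_same_act"
    by (simp add: reflp_def eventually_same_act_def)
  show "symp eventually_same_act"
    unfolding symp_def eventually_same_act_def by metis
  show "transp eventually_same_act"
    by (blast intro: transpI eventually_same_act_trans)
qed

lemma eventually_same_act_mult_right:
  assumes "eventually_same_act A B"
  shows "eventually_same_act (tree_mult A C) (tree_mult B C)"
  using assms unfolding eventually_same_act_def by (metis tree_mult_act)

text \<open>A long word turns the left factor into a single word that is still long, and this is the word
  that acts on the right factor.\<close>

lemma eventually_same_act_mult_left: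
  assumes "eventually_same_act B C"
  shows "eventually_same_act (tree_mult A B) (tree_mult A C)"
proof -
  obtain n where n: "\<And>w. n \<le> length w \<Longrightarrow> act w B = act w C"
    using assms unfolding eventually_same_act_def by blast
  obtain d where d:
    "\<And>w. d \<le> length w \<Longrightarrow> \<exists>u. act w A = Leaf u \<and> length w \<le> length u + d"
    using long_word_act_Leaf by blast
  have "act w (tree_mult A B) = act w (tree_mult A C)" if "n + d \<le> length w" for w
  proof -
    obtain u where "act w A = Leaf u" and "length w \<le> length u + d"
      using d[of w] \<open>n + d \<le> length w\<close> by auto
    then show ?thesis
      using n[of u] \<open>n + d \<le> length w\<close> by (simp flip: tree_mult_act)
  qed
  then show ?thesis
    unfolding eventually_same_act_def by blast
qed

lemma eventually_same_act_Fork: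
  assumes "eventually_same_act A B" and "eventually_same_act C D"
  shows "eventually_same_act (Fork A C) (Fork B D)"
proof -
  obtain m n where m: "\<And>w. m \<le> length w \<Longrightarrow> act w A = act w B"
    and n: "\<And>w. n \<le> length w \<Longrightarrow> act w C = act w D"
    using assms unfolding eventually_same_act_def by blast
  have "act w (Fork A C) = act w (Fork B D)" if long: "Suc (max m n) \<le> length w" for w
  proof (cases w rule: rev_cases)
    case Nil
    then show ?thesis using long by simp
  next
    case (snoc v g)
    then show ?thesis using m[of v] n[of v] long by (cases g) (auto simp: act_append)
  qed
  then show ?thesis
    unfolding eventually_same_act_def by blast
qed

lemma cqp_congruence_eventually_same_act: "cqp_congruence eventually_same_act"
  unfolding cqp_congruence_def times_tree_def Sg_tree_def
proof (intro conjI allI impI)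
  fix A B C D assume "eventually_same_act A B" and "eventually_same_act C D"
  then show "eventually_same_act (tree_mult A C) (tree_mult B D)"
    by (metis eventually_same_act_trans eventually_same_act_mult_right eventually_same_act_mult_left)
qed (simp_all add: equivp_eventually_same_act eventually_same_act_Fork)

lemma eventually_same_act_pi: "eventually_same_act (Sg pi1 pi2) 1"
proof -
  have "act w (Sg pi1 pi2) = act w 1" if "1 \<le> length w" for w
  proof (cases w rule: rev_cases)
    case Nil
    then show ?thesis using that by simp
  next
    case (snoc v g)
    then show ?thesis
      by (cases g)
        (simp_all add: Sg_tree_def pi1_tree_def pi2_tree_def one_tree_def act_append act_Leaf)
  qed
  then show ?thesis
    unfolding eventually_same_act_def by blast
qed

text \<open>\<open>cp\<close> is the smallest congruence of this kind.\<close>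

lemma cp_imp_eventually_same_act: "cp A B \<Longrightarrow> eventually_same_act A B"
  unfolding cp_def
  using cqp_congruence_eventually_same_act eventually_same_act_pi by blast

section \<open>Leaf colors and cofiniteness\<close>

lemma leaf_colors_gen_act:
  "v \<in> set (leaf_colors (gen_act g A)) \<Longrightarrow> \<exists>x. \<exists>c\<in>set (leaf_colors A). v = x @ c"
proof (cases A)
  case (Leaf w)
  assume "v \<in> set (leaf_colors (gen_act g A))"
  with Leaf show ?thesis by (auto intro: exI[of _ "[g]"])
next
  case (Fork A1 A2)
  assume "v \<in> set (leaf_colors (gen_act g A))"
  with Fork show ?thesis by (cases g) (auto intro: exI[of _ "[]"])
qed

text \<open>As long as the word walks down inside the tree it only selects some of the leaves; after that it
  lengthens their colors on the left.\<close>

lemma leaf_colors_act: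
  "v \<in> set (leaf_colors (act u A)) \<Longrightarrow> \<exists>x. \<exists>c\<in>set (leaf_colors A). v = x @ c"
proof (induction u arbitrary: v)
  case Nil
  then show ?case by (auto intro: exI[of _ "[]"])
next
  case (Cons g u)
  obtain y c' where "c' \<in> set (leaf_colors (act u A))" and v: "v = y @ c'"
    using leaf_colors_gen_act Cons.prems by (metis act_Cons)
  then obtain x c where "c \<in> set (leaf_colors A)" and "c' = x @ c"
    using Cons.IH by blast
  then show ?case using v by (metis append.assoc)
qed

lemma leaf_color_path: "c \<in> set (leaf_colors A) \<Longrightarrow> \<exists>p. act p A = Leaf c"
proof (induction A)
  case (Leaf w)
  then show ?case by (auto intro: exI[of _ "[]"])
next
  case (Fork A1 A2)
  have "act (p @ [P1]) (Fork A1 A2) = act p A1" "act (p @ [P2]) (Fork A1 A2) = act p A2" for p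
    by (simp_all add: act_append)
  then show ?case using Fork by (metis Un_iff leaf_colors.simps(2) set_append)
qed

lemma finite_short_words: "finite {w :: word. length w < n}"
proof -
  have "(UNIV :: generator set) = {P1, P2}"
    using generator.exhaust by blast
  then have "finite (UNIV :: generator set)"
    by (metis finite.emptyI finite.insertI)
  then have "finite {w :: word. set w \<subseteq> UNIV \<and> length w \<le> n}"
    by (rule finite_lists_length_le)
  then show ?thesis
    by (rule rev_finite_subset) auto
qed

lemma finite_words_iff_bounded:
  fixes X :: "word set"
  shows "finite X \<longleftrightarrow> (\<exists>n. \<forall>y. n \<le> length y \<longrightarrow> y \<notin> X)"
proof
  assume "finite X"
  then have "finite (length ` X)"
    by (rule finite_imageI)
  then obtain n where n: "\<forall>k\<in>length ` X. k < n"
    unfolding finite_nat_set_iff_bounded by blast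
  have "y \<notin> X" if "n \<le> length y" for y
    using n that by auto
  then show "\<exists>n. \<forall>y. n \<le> length y \<longrightarrow> y \<notin> X" by blast
next
  assume "\<exists>n. \<forall>y. n \<le> length y \<longrightarrow> y \<notin> X"
  then obtain n where "\<And>y. n \<le> length y \<Longrightarrow> y \<notin> X" by blast
  then have "X \<subseteq> {w. length w < n}"
    using not_le by blast
  then show "finite X"
    using finite_short_words by (rule finite_subset)
qed

lemma left_cofinite_iff_long_words:
  fixes ws :: "word list"
  shows "left_cofinite ws \<longleftrightarrow> (\<exists>n. \<forall>y. n \<le> length y \<longrightarrow> (\<exists>x. \<exists>c\<in>set ws. y = x @ c))"
proof -
  have "(\<exists>i<length ws. y = x @ ws ! i) \<longleftrightarrow> (\<exists>c\<in>set ws. y = x @ c)" for x y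
    by (auto simp: in_set_conv_nth)
  then show ?thesis
    unfolding left_cofinite_def finite_words_iff_bounded by simp
qed

section \<open>Left inverses\<close>

lemma cp_Fork: "cp A B \<Longrightarrow> cp C D \<Longrightarrow> cp (Fork A C) (Fork B D)"
  using cp_congruence unfolding cqp_congruence_def Sg_tree_def by blast

text \<open>This is the defining relation \<open>cp_pi\<close> multiplied on the right by \<open>w\<close>.\<close>

lemma cp_Fork_Leaf: "cp (Fork (Leaf (P1 # w)) (Leaf (P2 # w))) (Leaf w)"
proof -
  have "cp (Sg pi1 pi2 * Leaf w) (1 * Leaf w)"
    using cp_congruence cp_pi equivp_reflp[OF cp_equivp] unfolding cqp_congruence_def by blast
  then show ?thesis
    by (simp add: Sg_tree_def pi1_tree_def pi2_tree_def one_tree_def times_tree_def)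
qed

text \<open>The multiplier is the word that walks down to a leaf of color \<open>c\<close> and then prepends \<open>x\<close>.\<close>

lemma suffix_color_left_multiple:
  assumes "c \<in> set (leaf_colors B)"
  shows "\<exists>A. tree_mult A B = Leaf (x @ c)"
proof -
  obtain p where "act p B = Leaf c"
    using leaf_color_path[OF assms] by blast
  then have "tree_mult (Leaf (x @ p)) B = Leaf (x @ c)"
    by (simp add: act_append act_Leaf)
  then show ?thesis by blast
qed

text \<open>Induction on \<open>k\<close> descends from the words of length \<open>n\<close> to those of length \<open>n - k\<close>: the left
  multipliers for \<open>P1 # w\<close> and \<open>P2 # w\<close> fork to one for \<open>w\<close>.\<close>

lemma left_multiple_if_long_words:
  assumes "\<And>y. length y = n \<Longrightarrow> \<exists>A. cp (tree_mult A B) (Leaf y)"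
  shows "length w + k = n \<Longrightarrow> \<exists>A. cp (tree_mult A B) (Leaf w)"
proof (induction k arbitrary: w)
  case 0
  then show ?case using assms by simp
next
  case (Suc k)
  obtain A1 A2 where "cp (tree_mult A1 B) (Leaf (P1 # w))" "cp (tree_mult A2 B) (Leaf (P2 # w))"
    using Suc.IH[of "P1 # w"] Suc.IH[of "P2 # w"] Suc.prems by auto
  then have "cp (tree_mult (Fork A1 A2) B) (Fork (Leaf (P1 # w)) (Leaf (P2 # w)))"
    by (simp add: cp_Fork)
  then show ?case
    using cp_Fork_Leaf equivp_transp[OF cp_equivp] by blast
qed

lemma left_inverse_iff_cp:
  "(\<exists>A. A * class_of B = 1) \<longleftrightarrow> (\<exists>A. cp (tree_mult A B) (Leaf []))"
proof -
  have class_of: "class_of A * class_of B = 1 \<longleftrightarrow> cp (tree_mult A B) (Leaf [])" for A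
    by (simp add: times_U.abs_eq one_U.abs_eq U.abs_eq_iff times_tree_def one_tree_def)
  show ?thesis
  proof
    assume "\<exists>A. A * class_of B = 1"
    then obtain A where A: "A * class_of B = 1" ..
    obtain At where "A = class_of At"
      by (induction A rule: U.abs_induct) simp
    with A show "\<exists>A. cp (tree_mult A B) (Leaf [])"
      by (auto simp: class_of)
  next
    assume "\<exists>A. cp (tree_mult A B) (Leaf [])"
    then obtain A where "cp (tree_mult A B) (Leaf [])" ..
    then show "\<exists>A. A * class_of B = 1"
      by (intro exI[of _ "class_of A"]) (simp add: class_of)
  qed
qed

text \<open>For long \<open>y\<close>, acting with \<open>y\<close> on both sides of \<open>A B = 1\<close> gives \<open>u B = y\<close> for the single word
  \<open>u = y A\<close>.\<close>

lemma left_inverse_imp_left_cofinite: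
  assumes "cp (tree_mult A B) (Leaf [])"
  shows "left_cofinite (leaf_colors B)"
proof -
  obtain n where n: "\<And>w. n \<le> length w \<Longrightarrow> act w (tree_mult A B) = act w (Leaf [])"
    using cp_imp_eventually_same_act[OF assms] unfolding eventually_same_act_def by blast
  obtain d where d: "\<And>w. d \<le> length w \<Longrightarrow> \<exists>u. act w A = Leaf u"
    using long_word_act_Leaf[of A] by blast
  have "\<exists>x. \<exists>c\<in>set (leaf_colors B). y = x @ c" if long: "max n d \<le> length y" for y
  proof -
    obtain u where u: "act y A = Leaf u"
      using d[of y] long by auto
    have "act u B = tree_mult (act y A) B"
      by (simp add: u)
    also have "\<dots> = Leaf y"
      using n[of y] long by (simp add: tree_mult_act act_Leaf)
    finally show ?thesis
      using leaf_colors_act[of y u B] by simp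
  qed
  then show ?thesis
    unfolding left_cofinite_iff_long_words by blast
qed

lemma left_cofinite_imp_left_inverse:
  assumes "left_cofinite (leaf_colors B)"
  shows "\<exists>A. cp (tree_mult A B) (Leaf [])"
proof -
  obtain n where n: "\<And>y. n \<le> length y \<Longrightarrow> \<exists>x. \<exists>c\<in>set (leaf_colors B). y = x @ c"
    using assms unfolding left_cofinite_iff_long_words by blast
  have "\<exists>A. cp (tree_mult A B) (Leaf y)" if "length y = n" for y
  proof -
    obtain x c where "c \<in> set (leaf_colors B)" and y: "y = x @ c"
      using n[of y] \<open>length y = n\<close> by blast
    then obtain A where "tree_mult A B = Leaf y"
      using suffix_color_left_multiple by blast
    then show ?thesis
      using equivp_reflp[OF cp_equivp] by metis
  qed
  then show ?thesis
    using left_multiple_if_long_words[of n B "[]" n] by simp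
qed

theorem theorem3:
  fixes B :: U and Bt :: tree
  assumes "B = class_of Bt"
  shows "(\<exists>A::U. A * B = 1) \<longleftrightarrow> left_cofinite (leaf_colors Bt)"
  unfolding assms left_inverse_iff_cp
  using left_inverse_imp_left_cofinite left_cofinite_imp_left_inverse by blast

end
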